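(* Let $G$ be a finite $3$-group and $H\cong C_9\times C_3$ a normal subgroup of $G$ such that $G/H$ is colourable. Then $G$ is colourable.
   Context: A bijection $\sigma$ of a group $Q$ is a colouring bijection if the maps $x\mapsto\sigma(x)x$, $x\mapsto x^{-1}\sigma(x)$, $x\mapsto x^{-1}\sigma(x)x$ are all bijections of $Q$; $Q$ is colourable if it admits a colouring bijection. *)

theory Defs
  imports "HOL-Algebra.Elementary_Groups"
begin

text \<open>
  All four maps are only constrained on the carrier; values of \<open>\<sigma>\<close> outside it are irrelevant.
\<close>

definition colouring_bijection ::
    "('a, 'b) monoid_scheme \<Rightarrow> ('a \<Rightarrow> 'a) \<Rightarrow> bool" where
  "colouring_bijection Q \<sigma> \<longleftrightarrow>
     bij_betw \<sigma> (carrier Q) (carrier Q) \<and>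
     bij_betw (\<lambda>x. \<sigma> x \<otimes>\<^bsub>Q\<^esub> x) (carrier Q) (carrier Q) \<and>
     bij_betw (\<lambda>x. inv\<^bsub>Q\<^esub> x \<otimes>\<^bsub>Q\<^esub> \<sigma> x) (carrier Q) (carrier Q) \<and>
     bij_betw (\<lambda>x. inv\<^bsub>Q\<^esub> x \<otimes>\<^bsub>Q\<^esub> \<sigma> x \<otimes>\<^bsub>Q\<^esub> x) (carrier Q) (carrier Q)"

definition colourable :: "('a, 'b) monoid_scheme \<Rightarrow> bool" where
  "colourable Q \<longleftrightarrow> (\<exists>\<sigma>. colouring_bijection Q \<sigma>)"

definition finite_p_group :: "nat \<Rightarrow> ('a, 'b) monoid_scheme \<Rightarrow> bool" where
  "finite_p_group p G \<longleftrightarrow>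
     group G \<and> finite (carrier G) \<and> (\<exists>n. order G = p ^ n)"

end

theory Submission
  imports Defs "HOL-Algebra.Multiplicative_Group"
begin

text \<open>
  Lift a colouring bijection \<open>\<tau>\<close> of \<open>G/H\<close> coset by coset: if \<open>x\<close> and \<open>y\<close> represent a coset and its
  image under \<open>\<tau>\<close>, put \<open>\<sigma>(hx) = \<phi>(h)y\<close>. The four maps of \<open>\<sigma>\<close> restrict to bijections between
  cosets of \<open>H\<close> as soon as, with \<open>\<alpha>\<close> denoting conjugation by \<open>y\<close> and \<open>H\<close> written additively,
  \<open>\<phi>\<close>, \<open>\<phi> + \<alpha>\<close>, \<open>\<phi> - 1\<close> and \<open>\<phi> + \<alpha> - 1\<close> are bijections of \<open>H\<close>. On \<open>C\<^sub>9 \<times> C\<^sub>3\<close> an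
  automorphism of odd order has the form \<open>(x, y) \<mapsto> (ax + 3by, cx + y)\<close> with \<open>a \<equiv> 1\<close> modulo 3.
  No endomorphism \<open>\<phi>\<close> works, because it would act on \<open>H/\<Omega>\<^sub>1(H)\<close> by a scalar avoiding 0, 1 and -1
  modulo 3. However, four maps of the shape \<open>\<phi>(x, y) = f(x) + y(s, t)\<close> serve all 27
  automorphisms.
\<close>

section \<open>Lifting colourings along a normal subgroup\<close>

text \<open>With \<open>g = h x\<close> and \<open>\<sigma> g = \<phi>(h) y\<close>, the rule
  \<open>y h = \<alpha>(h) y\<close> collects the factors from \<open>H\<close>, leaving these four
  products between the coset representatives. Their order is kept, so the lifting applies to
  nonabelian \<open>H\<close> too.\<close>

definition twisted_colouring ::
    "('a, 'b) monoid_scheme \<Rightarrow> ('a \<Rightarrow> 'a) \<Rightarrow> ('a \<Rightarrow> 'a) \<Rightarrow> bool" where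
  "twisted_colouring K \<alpha> \<phi> \<longleftrightarrow>
     bij_betw \<phi> (carrier K) (carrier K) \<and>
     bij_betw (\<lambda>h. \<phi> h \<otimes>\<^bsub>K\<^esub> \<alpha> h) (carrier K) (carrier K) \<and>
     bij_betw (\<lambda>h. inv\<^bsub>K\<^esub> h \<otimes>\<^bsub>K\<^esub> \<phi> h) (carrier K) (carrier K) \<and>
     bij_betw (\<lambda>h. inv\<^bsub>K\<^esub> h \<otimes>\<^bsub>K\<^esub> \<phi> h \<otimes>\<^bsub>K\<^esub> \<alpha> h) (carrier K) (carrier K)"

lemma bij_betw_conjugate:
  assumes f: "bij_betw f A B" and g: "bij_betw g B B"
    and eq: "\<And>a. a \<in> A \<Longrightarrow> k a \<in> A \<and> f (k a) = g (f a)"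
  shows "bij_betw k A A"
proof -
  have "bij_betw (inv_into A f \<circ> (g \<circ> f)) A A"
    using f g by (blast intro: bij_betw_trans bij_betw_inv_into)
  moreover have "(inv_into A f \<circ> (g \<circ> f)) a = k a" if "a \<in> A" for a
    using eq[OF that] f by (metis bij_betw_inv_into_left comp_apply)
  ultimately show ?thesis
    using bij_betw_cong by blast
qed

text \<open>Here \<open>\<psi>\<close> is \<open>\<phi>\<close> conjugated by \<open>f\<close>. As
  \<open>f\<close> is a homomorphism carrying \<open>\<beta>\<close> to \<open>\<alpha>\<close>, it
  conjugates each of the four maps of \<open>\<psi>\<close> to the matching map of
  \<open>\<phi>\<close>.\<close>

lemma twisted_colouring_iso:
  assumes "group K" "group L" and f: "f \<in> iso K L"
    and \<beta>: "\<And>h. h \<in> carrier K \<Longrightarrow> \<beta> h \<in> carrier K \<and> f (\<beta> h) = \<alpha> (f h)"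
    and L: "twisted_colouring L \<alpha> \<phi>"
  shows "\<exists>\<psi>. twisted_colouring K \<beta> \<psi>"
proof -
  interpret group_hom K L f
    using assms by (simp add: group_hom_def group_hom_axioms_def iso_def)
  have bij: "bij_betw f (carrier K) (carrier L)"
    using f by (simp add: iso_def)
  define \<psi> where "\<psi> h = inv_into (carrier K) f (\<phi> (f h))" for h
  have \<phi>: "bij_betw \<phi> (carrier L) (carrier L)"
    using L by (simp add: twisted_colouring_def)
  have \<psi>: "\<psi> h \<in> carrier K" "f (\<psi> h) = \<phi> (f h)" if "h \<in> carrier K" for h
  proof -
    have "\<phi> (f h) \<in> carrier L"
      using that \<phi> by (meson bij_betwE hom_closed)
    then show "\<psi> h \<in> carrier K" "f (\<psi> h) = \<phi> (f h)"
      using bij unfolding \<psi>_def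
      by (meson bij_betw_def bij_betw_inv_into bij_betwE, meson bij bij_betw_inv_into_right)
  qed
  have "twisted_colouring K \<beta> \<psi>"
    using L unfolding twisted_colouring_def
    by (elim conjE, intro conjI; elim bij_betw_conjugate[OF bij]) (simp_all add: \<psi> \<beta>)
  then show ?thesis by blast
qed

section \<open>Bijections of a group assembled coset by coset\<close>

context normal
begin

text \<open>Points with equal images lie in cosets with the same image under \<open>T\<close>, hence
  in one coset, where \<open>f\<close> is injective. Surjectivity of \<open>T\<close> reaches every
  target coset.\<close>

lemma bij_betw_rcosets:
  assumes T: "bij_betw T (carrier (G Mod H)) (carrier (G Mod H))"
    and f: "\<And>q. q \<in> carrier (G Mod H) \<Longrightarrow> bij_betw f q (T q)"
  shows "bij_betw f (carrier G) (carrier G)"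
proof -
  have carr: "carrier (G Mod H) = rcosets H"
    by (simp add: FactGroup_def)
  have union: "\<Union>(rcosets H) = carrier G"
    using rcosets_part_G subgroup_axioms by blast
  have disj: "q = q'" if "q \<in> rcosets H" "q' \<in> rcosets H" "z \<in> q" "z \<in> q'" for q q' z
    using rcos_disjoint[OF subgroup_axioms] that by (auto simp: pairwise_def disjnt_def)
  have Tcl: "T q \<in> rcosets H" if "q \<in> rcosets H" for q
    using T that carr by (metis bij_betwE)
  show ?thesis
    unfolding bij_betw_def
  proof (intro conjI inj_onI equalityI subsetI)
    fix g g' assume "g \<in> carrier G" "g' \<in> carrier G" and eq: "f g = f g'"
    then obtain q q' where q: "q \<in> rcosets H" "g \<in> q" "q' \<in> rcosets H" "g' \<in> q'"
      using union by (metis UnionE)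
    then have "f g \<in> T q" "f g' \<in> T q'"
      using f carr by (metis bij_betwE)+
    then have "T q = T q'"
      using disj Tcl q eq by metis
    then have "q = q'"
      using T q carr by (metis bij_betw_imp_inj_on inj_onD)
    then show "g = g'"
      using f[of q] q eq carr by (metis bij_betw_imp_inj_on inj_onD)
  next
    fix z assume "z \<in> f ` carrier G"
    then obtain q g where "q \<in> rcosets H" "g \<in> q" "z = f g"
      using union by (metis UnionE imageE)
    then have "z \<in> T q" "T q \<in> rcosets H"
      using f carr Tcl by (auto dest: bij_betwE)
    then show "z \<in> carrier G"
      using union by blast
  next
    fix z assume "z \<in> carrier G"
    then obtain r where r: "r \<in> rcosets H" "z \<in> r"
      using union by (metis UnionE)
    then obtain q where q: "q \<in> rcosets H" "r = T q"
      using T carr by (metis bij_betw_imp_surj_on imageE)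
    then obtain g where "g \<in> q" "z = f g"
      using r f[of q] carr by (metis bij_betw_imp_surj_on imageE)
    then show "z \<in> f ` carrier G"
      using q union by blast
  qed
qed

text \<open>Normality moves \<open>w\<close> past \<open>\<psi> h\<close>:
  \<open>w \<psi>(h) z = (w \<psi>(h) w^-1) (w z)\<close>. This serves the maps that begin with
  \<open>inv g\<close>, where \<open>w\<close> is \<open>inv x\<close>.\<close>

lemma bij_betw_rcoset:
  assumes \<psi>: "bij_betw \<psi> H H" and x: "x \<in> carrier G" and w: "w \<in> carrier G" and z: "z \<in> carrier G"
    and f: "\<And>h. h \<in> H \<Longrightarrow> f (h \<otimes> x) = w \<otimes> \<psi> h \<otimes> z"
  shows "bij_betw f (H #> x) (H #> (w \<otimes> z))"
proof -
  have \<psi>H: "\<psi> h \<in> H" if "h \<in> H" for h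
    using \<psi> that by (meson bij_betwE)
  have f': "f (h \<otimes> x) = (w \<otimes> \<psi> h \<otimes> inv w) \<otimes> (w \<otimes> z)" if "h \<in> H" for h
    using f[OF that] \<psi>H[OF that] w z by (simp add: m_assoc inv_solve_left' flip: m_assoc[of "inv w" w z])
  show ?thesis
    unfolding bij_betw_def
  proof (intro conjI inj_onI equalityI subsetI)
    fix g g' assume "g \<in> H #> x" "g' \<in> H #> x" and eq: "f g = f g'"
    then obtain h h' where h: "h \<in> H" "g = h \<otimes> x" "h' \<in> H" "g' = h' \<otimes> x"
      by (auto simp: r_coset_def)
    then have "\<psi> h = \<psi> h'"
      using eq f \<psi>H w z by simp
    then show "g = g'"
      using h \<psi> by (metis bij_betw_imp_inj_on inj_onD)
  next
    fix u assume "u \<in> f ` (H #> x)"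
    then obtain h where "h \<in> H" "u = (w \<otimes> \<psi> h \<otimes> inv w) \<otimes> (w \<otimes> z)"
      using f' by (auto simp: r_coset_def)
    then show "u \<in> H #> (w \<otimes> z)"
      using inv_op_closed2[OF w \<psi>H] by (auto simp: r_coset_def)
  next
    fix u assume "u \<in> H #> (w \<otimes> z)"
    then obtain k where k: "k \<in> H" "u = k \<otimes> (w \<otimes> z)"
      by (auto simp: r_coset_def)
    have "inv w \<otimes> k \<otimes> w \<in> H"
      using inv_op_closed1[OF w] k by simp
    then obtain h where h: "h \<in> H" "\<psi> h = inv w \<otimes> k \<otimes> w"
      using \<psi> by (metis bij_betw_imp_surj_on imageE)
    have "w \<otimes> (inv w \<otimes> k \<otimes> w) \<otimes> z = u"
      using k w z by (simp add: m_assoc[symmetric])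
    then have "f (h \<otimes> x) = u"
      using f h by simp
    then show "u \<in> f ` (H #> x)"
      using h by (auto simp: r_coset_def)
  qed
qed

text \<open>The map \<open>\<phi>\<close> may depend on \<open>y\<close>, since the only twist met
  on a coset is conjugation by the representative \<open>y\<close> of its image under the quotient
  colouring.\<close>

theorem colourable_extension:
  assumes Q: "colourable (G Mod H)"
    and \<phi>: "\<And>y. y \<in> carrier G \<Longrightarrow>
          \<exists>\<phi>. twisted_colouring (G\<lparr>carrier := H\<rparr>) (\<lambda>h. y \<otimes> h \<otimes> inv y) \<phi>"
  shows "colourable G"
proof -
  let ?Q = "G Mod H"
  obtain \<tau> where \<tau>: "colouring_bijection ?Q \<tau>"
    using Q by (auto simp: colourable_def)
  obtain \<Phi> where \<Phi>: "twisted_colouring (G\<lparr>carrier := H\<rparr>) (\<lambda>h. y \<otimes> h \<otimes> inv y) (\<Phi> y)"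
    if "y \<in> carrier G" for y
    using \<phi> by metis
  define r where "r q = (SOME x. x \<in> carrier G \<and> q = H #> x)" for q
  have r: "r q \<in> carrier G" "q = H #> r q" if "q \<in> carrier ?Q" for q
  proof -
    have "\<exists>x. x \<in> carrier G \<and> q = H #> x"
      using that by (auto simp: carrier_FactGroup)
    from someI_ex[OF this] show "r q \<in> carrier G" "q = H #> r q"
      unfolding r_def by blast+
  qed
  \<comment> \<open>For \<open>g = h x\<close> with \<open>x = r q\<close>, the argument
    \<open>g \<otimes> inv (r q)\<close> recovers \<open>h\<close>.\<close>
  define \<sigma> where
    "\<sigma> g = (let q = H #> g; y = r (\<tau> q) in \<Phi> y (g \<otimes> inv (r q)) \<otimes> y)" for g
  have \<tau>cl: "\<tau> q \<in> carrier ?Q" if "q \<in> carrier ?Q" for q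
    using \<tau> that by (auto simp: colouring_bijection_def dest: bij_betwE)
  \<comment> \<open>The four maps of \<open>\<sigma>\<close> lie over the four maps of
    \<open>\<tau>\<close>, which permute the cosets.\<close>
  have fibre:
    "bij_betw \<sigma> q (\<tau> q)"
    "bij_betw (\<lambda>g. \<sigma> g \<otimes> g) q (\<tau> q \<otimes>\<^bsub>?Q\<^esub> q)"
    "bij_betw (\<lambda>g. inv g \<otimes> \<sigma> g) q (inv\<^bsub>?Q\<^esub> q \<otimes>\<^bsub>?Q\<^esub> \<tau> q)"
    "bij_betw (\<lambda>g. inv g \<otimes> \<sigma> g \<otimes> g) q (inv\<^bsub>?Q\<^esub> q \<otimes>\<^bsub>?Q\<^esub> \<tau> q \<otimes>\<^bsub>?Q\<^esub> q)"
    if q: "q \<in> carrier ?Q" for q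
  proof -
    define x y where "x = r q" and "y = r (\<tau> q)"
    have x: "x \<in> carrier G" "q = H #> x"
      using r[OF q] by (auto simp: x_def)
    have y: "y \<in> carrier G" "\<tau> q = H #> y"
      using r[OF \<tau>cl[OF q]] by (auto simp: y_def)
    have inv_q: "inv\<^bsub>?Q\<^esub> (H #> x) = H #> inv x"
      using inv_FactGroup[OF q] x rcos_inv by simp
    have inv_H: "inv\<^bsub>G\<lparr>carrier := H\<rparr>\<^esub> h = inv h" if "h \<in> H" for h
      using that by (simp add: m_inv_consistent subgroup_axioms)
    have bij: "bij_betw (\<Phi> y) H H"
      "bij_betw (\<lambda>h. \<Phi> y h \<otimes> (y \<otimes> h \<otimes> inv y)) H H"
      "bij_betw (\<lambda>h. inv h \<otimes> \<Phi> y h) H H"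
      "bij_betw (\<lambda>h. inv h \<otimes> \<Phi> y h \<otimes> (y \<otimes> h \<otimes> inv y)) H H"
    proof -
      have *: "bij_betw (\<lambda>h. k (inv\<^bsub>G\<lparr>carrier := H\<rparr>\<^esub> h) h) H H \<longleftrightarrow> bij_betw (\<lambda>h. k (inv h) h) H H"
        for k :: "'a \<Rightarrow> 'a \<Rightarrow> 'a"
        by (rule bij_betw_cong) (simp add: inv_H)
      show "bij_betw (\<Phi> y) H H"
        "bij_betw (\<lambda>h. \<Phi> y h \<otimes> (y \<otimes> h \<otimes> inv y)) H H"
        "bij_betw (\<lambda>h. inv h \<otimes> \<Phi> y h) H H"
        "bij_betw (\<lambda>h. inv h \<otimes> \<Phi> y h \<otimes> (y \<otimes> h \<otimes> inv y)) H H"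
        using \<Phi>[OF y(1)] *[of "\<lambda>u h. u \<otimes> \<Phi> y h"]
          *[of "\<lambda>u h. u \<otimes> \<Phi> y h \<otimes> (y \<otimes> h \<otimes> inv y)"]
        by (simp_all add: twisted_colouring_def)
    qed
    have \<Phi>G: "\<Phi> y h \<in> carrier G" if "h \<in> H" for h
      using bij(1) that by (metis bij_betwE mem_carrier)
    have \<sigma>: "\<sigma> (h \<otimes> x) = \<Phi> y h \<otimes> y" if "h \<in> H" for h
    proof -
      have "H #> (h \<otimes> x) = q"
        using that x by (metis coset_join2 coset_mult_assoc mem_carrier subgroup_axioms subset)
      then show ?thesis
        using that x(1) by (simp add: \<sigma>_def x_def[symmetric] y_def[symmetric] m_assoc)
    qed
    have canc2: "inv y \<otimes> (y \<otimes> u) = u" if "u \<in> carrier G" for u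
      using that y by (simp flip: m_assoc)
    show "bij_betw \<sigma> q (\<tau> q)"
      using bij_betw_rcoset[OF bij(1) x(1) one_closed y(1), of \<sigma>] \<sigma> \<Phi>G x y by simp
    \<comment> \<open>Since \<open>y h x = (y h y^-1) (y x)\<close>, the target coset has
      representative \<open>y x\<close>.\<close>
    show "bij_betw (\<lambda>g. \<sigma> g \<otimes> g) q (\<tau> q \<otimes>\<^bsub>?Q\<^esub> q)"
      using bij_betw_rcoset[OF bij(2) x(1) one_closed, of "y \<otimes> x" "\<lambda>g. \<sigma> g \<otimes> g"] \<sigma> \<Phi>G x y
      by (simp add: rcos_sum m_assoc canc2)
    show "bij_betw (\<lambda>g. inv g \<otimes> \<sigma> g) q (inv\<^bsub>?Q\<^esub> q \<otimes>\<^bsub>?Q\<^esub> \<tau> q)"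
      using bij_betw_rcoset[OF bij(3) x(1), of "inv x" y "\<lambda>g. inv g \<otimes> \<sigma> g"] \<sigma> \<Phi>G x y
      by (simp add: inv_q rcos_sum m_assoc inv_mult_group)
    show "bij_betw (\<lambda>g. inv g \<otimes> \<sigma> g \<otimes> g) q (inv\<^bsub>?Q\<^esub> q \<otimes>\<^bsub>?Q\<^esub> \<tau> q \<otimes>\<^bsub>?Q\<^esub> q)"
      using bij_betw_rcoset[OF bij(4) x(1), of "inv x" "y \<otimes> x" "\<lambda>g. inv g \<otimes> \<sigma> g \<otimes> g"] \<sigma> \<Phi>G x y
      by (simp add: inv_q rcos_sum m_assoc inv_mult_group canc2)
  qed
  have "colouring_bijection G \<sigma>"
    using \<tau> unfolding colouring_bijection_def
    by (elim conjE, intro conjI; elim bij_betw_rcosets) (rule fibre, assumption)+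
  then show ?thesis
    by (auto simp: colourable_def)
qed

end

section \<open>Twisted colourings of \<open>C\<^sub>9 \<times> C\<^sub>3\<close>\<close>

definition c9c3_points :: "(int \<times> int) list" where
  "c9c3_points = List.product [0..8] [0..2]"

text \<open>For fixed \<open>x\<close>, the four maps of a colouring twisted by
  \<open>c9c3_aut a b c\<close> are affine in \<open>y\<close> with slopes \<open>(s, t)\<close>,
  \<open>(s + 3b, t + 1)\<close>, \<open>(s, t - 1)\<close> and \<open>(s + 3b, t)\<close>. When 3
  divides \<open>s\<close>, bijectivity means that each slope is nonzero and that the nine values at
  \<open>y = 0\<close> lie in distinct cosets of the subgroup generated by that slope.\<close>

definition table_map :: "int \<Rightarrow> int \<Rightarrow> (int \<times> int) list \<Rightarrow> int \<times> int \<Rightarrow> int \<times> int" where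
  "table_map s t f = (\<lambda>(x, y). ((fst (f ! nat x) + s * y) mod 9, (snd (f ! nat x) + t * y) mod 3))"

definition c9c3_aut :: "int \<Rightarrow> int \<Rightarrow> int \<Rightarrow> int \<times> int \<Rightarrow> int \<times> int" where
  "c9c3_aut a b c = (\<lambda>(x, y). ((a * x + 3 * b * y) mod 9, (c * x + y) mod 3))"

definition c9c3_add :: "int \<times> int \<Rightarrow> int \<times> int \<Rightarrow> int \<times> int" where
  "c9c3_add = (\<lambda>(x, y) (x', y'). ((x + x') mod 9, (y + y') mod 3))"

definition c9c3_neg :: "int \<times> int \<Rightarrow> int \<times> int" where
  "c9c3_neg = (\<lambda>(x, y). ((- x) mod 9, (- y) mod 3))"

text \<open>The first two tests do not involve the automorphism, so all triples in \<open>L\<close>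
  share them.\<close>

definition table_check where
  "table_check s t f L \<longleftrightarrow>
     distinct (map (table_map s t f) c9c3_points) \<and>
     distinct (map (\<lambda>h. c9c3_add (c9c3_neg h) (table_map s t f h)) c9c3_points) \<and>
     list_all (\<lambda>(a, b, c).
       distinct (map (\<lambda>h. c9c3_add (table_map s t f h) (c9c3_aut a b c h)) c9c3_points) \<and>
       distinct (map (\<lambda>h. c9c3_add (c9c3_add (c9c3_neg h) (table_map s t f h)) (c9c3_aut a b c h)) c9c3_points)) L"

text \<open>The four tables were found by a computer search.\<close>

lemma table1:
  "table_check 3 0 [(0,0),(0,2),(8,0),(7,1),(5,1),(3,1),(2,2),(1,0),(1,2)]
     [(1,0,0),(4,0,2),(7,0,0),(7,0,2),(1,1,0),(4,1,0),(4,1,2),(7,1,2)]"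
  by code_simp

lemma table2:
  "table_check 3 1 [(0,0),(1,2),(7,0),(4,1),(5,0),(3,2),(8,2),(6,1),(2,1)]
     [(1,0,2),(4,0,1),(1,1,1),(7,1,0),(7,2,0),(7,2,1),(7,2,2)]"
  by code_simp

lemma table3:
  "table_check 6 0 [(0,0),(0,1),(2,1),(2,2),(4,2),(6,2),(1,1),(5,0),(7,0)]
     [(1,0,0),(1,0,1),(4,0,0),(7,0,1),(1,2,0),(4,2,0),(4,2,1),(7,2,1)]"
  by code_simp

lemma table4:
  "table_check 0 2 [(0,0),(2,0),(5,1),(7,1),(1,2),(4,0),(8,2),(3,1),(6,2)]
     [(1,1,2),(4,1,1),(4,1,2),(7,1,1),(1,2,1),(1,2,2),(4,2,2),(7,2,1)]"
  by code_simp

section \<open>The group \<open>C9C3\<close> and its agreement with the table arithmetic\<close>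

definition C9C3 :: "(int \<times> int) monoid" where
  "C9C3 = integer_mod_group 9 \<times>\<times> integer_mod_group 3"

lemma group_C9C3: "group C9C3"
  by (simp add: C9C3_def DirProd_group)

lemma carrier_C9C3: "carrier C9C3 = {0..<9} \<times> {0..<3}"
  by (simp add: C9C3_def carrier_integer_mod_group)

lemma set_c9c3_points: "set c9c3_points = carrier C9C3"
  by (auto simp: c9c3_points_def carrier_C9C3)

lemma mult_C9C3: "p \<otimes>\<^bsub>C9C3\<^esub> q = c9c3_add p q"
  by (simp add: C9C3_def mult_DirProd' c9c3_add_def split: prod.split)

lemma inv_C9C3: "p \<in> carrier C9C3 \<Longrightarrow> inv\<^bsub>C9C3\<^esub> p = c9c3_neg p"
  by (cases p) (simp add: C9C3_def c9c3_neg_def)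

lemma bij_betw_C9C3:
  assumes "distinct (map g c9c3_points)" and "\<And>p. g p \<in> carrier C9C3"
  shows "bij_betw g (carrier C9C3) (carrier C9C3)"
proof -
  have "inj_on g (carrier C9C3)"
    using assms(1) by (metis distinct_map set_c9c3_points)
  moreover have "finite (carrier C9C3)"
    by (metis List.finite_set set_c9c3_points)
  ultimately show ?thesis
    using assms(2) by (simp add: bij_betw_def endo_inj_surj image_subsetI)
qed

lemma c9c3_closed:
  "c9c3_add p q \<in> carrier C9C3" "table_map s t f p \<in> carrier C9C3"
  by (auto simp: c9c3_add_def table_map_def carrier_C9C3 split: prod.split)

lemma table_check_twisted_colouring:
  assumes chk: "table_check s t f L" and abc: "(a, b, c) \<in> set L"
  shows "\<exists>\<phi>. twisted_colouring C9C3 (c9c3_aut a b c) \<phi>"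
proof -
  have "bij_betw (table_map s t f) (carrier C9C3) (carrier C9C3)"
    "bij_betw (\<lambda>h. c9c3_add (table_map s t f h) (c9c3_aut a b c h)) (carrier C9C3) (carrier C9C3)"
    "bij_betw (\<lambda>h. c9c3_add (c9c3_neg h) (table_map s t f h)) (carrier C9C3) (carrier C9C3)"
    "bij_betw (\<lambda>h. c9c3_add (c9c3_add (c9c3_neg h) (table_map s t f h)) (c9c3_aut a b c h))
       (carrier C9C3) (carrier C9C3)"
    using chk abc by (auto simp: table_check_def list_all_iff c9c3_closed intro!: bij_betw_C9C3)
  moreover have "bij_betw (\<lambda>h. k (inv\<^bsub>C9C3\<^esub> h) h) (carrier C9C3) (carrier C9C3) \<longleftrightarrow>
      bij_betw (\<lambda>h. k (c9c3_neg h) h) (carrier C9C3) (carrier C9C3)"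
    for k :: "int \<times> int \<Rightarrow> int \<times> int \<Rightarrow> int \<times> int"
    by (rule bij_betw_cong) (simp add: inv_C9C3)
  note this[of "\<lambda>u h. c9c3_add u (table_map s t f h)"]
    this[of "\<lambda>u h. c9c3_add (c9c3_add u (table_map s t f h)) (c9c3_aut a b c h)"]
  ultimately have "twisted_colouring C9C3 (c9c3_aut a b c) (table_map s t f)"
    by (simp add: twisted_colouring_def mult_C9C3)
  then show ?thesis by blast
qed

text \<open>The lists of the four tables together contain all 27 triples, some of them
  repeatedly.\<close>

lemma twisted_colouring_C9C3:
  assumes "a \<in> {1, 4, 7}" "b \<in> {0, 1, 2}" "c \<in> {0, 1, 2}"
  shows "\<exists>\<phi>. twisted_colouring C9C3 (c9c3_aut a b c) \<phi>"
  using assms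
  by (auto intro: table1[THEN table_check_twisted_colouring] table2[THEN table_check_twisted_colouring]
      table3[THEN table_check_twisted_colouring] table4[THEN table_check_twisted_colouring])

section \<open>Automorphisms of \<open>C\<^sub>9 \<times> C\<^sub>3\<close> of odd order\<close>

text \<open>Squares are 0 or 1 modulo 3, so an odd power keeps the residue of its base.\<close>

lemma odd_power_mod_3:
  fixes a :: int
  assumes "odd k"
  shows "a ^ k mod 3 = a mod 3"
proof -
  obtain m where m: "k = Suc (2 * m)"
    using assms by (metis oddE Suc_eq_plus1)
  have "a mod 3 = 0 \<or> a mod 3 = 1 \<or> a mod 3 = 2"
    by presburger
  moreover have "2 ^ k mod 3 = (2::int)"
    unfolding m by (induction m) (simp_all, presburger)
  moreover have "0 < k" using m by simp
  ultimately show ?thesis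
    by (metis power_mod power_one power_0_left mod_0 mod_pos_pos_trivial one_less_numeral_iff
        semiring_norm(77) zero_le_one less_irrefl zero_power)
qed

text \<open>A homomorphism is determined by its values \<open>(a, c)\<close> and
  \<open>(e, d)\<close> at the generators \<open>(1, 0)\<close> and \<open>(0, 1)\<close>. The
  second generator is killed by 3, which forces \<open>e = 3 * b\<close>.\<close>

lemma hom_C9C3:
  assumes \<alpha>: "\<alpha> \<in> hom C9C3 C9C3"
  obtains a b c d where "a \<in> {0..<9}" "b \<in> {0, 1, 2}" "c \<in> {0, 1, 2}" "d \<in> {0, 1, 2}"
    "\<And>x y. (x, y) \<in> carrier C9C3 \<Longrightarrow> \<alpha> (x, y) = ((a * x + 3 * b * y) mod 9, (c * x + d * y) mod 3)"
proof -
  have carr: "(x, y) \<in> carrier C9C3 \<longleftrightarrow> 0 \<le> x \<and> x < 9 \<and> 0 \<le> y \<and> y < 3" for x y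
    by (auto simp: carrier_C9C3)
  have add: "\<alpha> ((x + x') mod 9, (y + y') mod 3) = c9c3_add (\<alpha> (x, y)) (\<alpha> (x', y'))"
    if "(x, y) \<in> carrier C9C3" "(x', y') \<in> carrier C9C3" for x y x' y'
    using hom_mult[OF \<alpha> that] unfolding mult_C9C3 by (simp add: c9c3_add_def)
  obtain a c where ac: "\<alpha> (1, 0) = (a, c)" by fastforce
  obtain e d where ed: "\<alpha> (0, 1) = (e, d)" by fastforce
  have "\<alpha> (1, 0) \<in> carrier C9C3" "\<alpha> (0, 1) \<in> carrier C9C3"
    using \<alpha> unfolding hom_def by (auto simp: carr dest!: funcset_mem)
  then have rng: "0 \<le> a" "a < 9" "0 \<le> c" "c < 3" "0 \<le> e" "e < 9" "0 \<le> d" "d < 3"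
    unfolding ac ed carr by auto
  have x: "\<alpha> (int n mod 9, 0) = ((a * int n) mod 9, (c * int n) mod 3)" for n
  proof (induction n)
    case 0
    have "\<alpha> (0, 0) \<in> carrier C9C3"
      using \<alpha> unfolding hom_def by (auto simp: carr dest!: funcset_mem)
    \<comment> \<open>An idempotent of a group is the identity.\<close>
    moreover have "\<alpha> (0, 0) = c9c3_add (\<alpha> (0, 0)) (\<alpha> (0, 0))"
      using add[of 0 0 0 0] by (simp add: carr)
    ultimately have "\<alpha> (0, 0) = (0, 0)"
      by (cases "\<alpha> (0, 0)") (simp add: carr c9c3_add_def, presburger)
    then show ?case by simp
  next
    case (Suc n)
    have "\<alpha> (int (Suc n) mod 9, 0) = c9c3_add (\<alpha> (int n mod 9, 0)) (\<alpha> (1, 0))"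
      using add[of "int n mod 9" 0 1 0] by (simp add: carr mod_simps add.commute)
    then show ?case
      by (simp add: Suc ac c9c3_add_def mod_simps algebra_simps)
  qed
  have y: "\<alpha> (0, int n mod 3) = ((e * int n) mod 9, (d * int n) mod 3)" for n
  proof (induction n)
    case 0
    show ?case using x[of 0] by simp
  next
    case (Suc n)
    have "\<alpha> (0, int (Suc n) mod 3) = c9c3_add (\<alpha> (0, int n mod 3)) (\<alpha> (0, 1))"
      using add[of 0 "int n mod 3" 0 1] by (simp add: carr mod_simps add.commute)
    then show ?case
      by (simp add: Suc ed c9c3_add_def mod_simps algebra_simps)
  qed
  \<comment> \<open>Both instances compute \<open>\<alpha> (0, 0)\<close>.\<close>
  have "(e * 3) mod 9 = 0"
    using y[of 3] y[of 0] by simp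
  then obtain b where b: "e = 3 * b" "b \<in> {0, 1, 2}"
    using rng by (intro that[of "e div 3"]) (simp, presburger)+
  show thesis
  proof (rule that)
    show "a \<in> {0..<9}" "b \<in> {0, 1, 2}" "c \<in> {0, 1, 2}" "d \<in> {0, 1, 2}"
      using rng b by auto
    fix x y assume xy: "(x, y) \<in> carrier C9C3"
    then have "\<alpha> (x, y) = c9c3_add (\<alpha> (x, 0)) (\<alpha> (0, y))"
      using add[of x 0 0 y] by (simp add: carr)
    then show "\<alpha> (x, y) = ((a * x + 3 * b * y) mod 9, (c * x + d * y) mod 3)"
      using x[of "nat x"] y[of "nat y"] xy b
      by (simp add: carr c9c3_add_def mod_simps)
  qed
qed

text \<open>On \<open>H\<close> modulo the subgroup of all \<open>(3x, y)\<close>,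
  \<open>\<alpha>\<close> multiplies by \<open>a\<close>; on that subgroup modulo all
  \<open>(3x, 0)\<close>, it multiplies by \<open>d\<close>. Hence \<open>a ^ k\<close> and
  \<open>d ^ k\<close> are 1 modulo 3, and oddness of \<open>k\<close> excludes the residue 2 for
  \<open>a\<close> and \<open>d\<close>.\<close>

lemma odd_order_aut_C9C3:
  assumes \<alpha>: "\<alpha> \<in> hom C9C3 C9C3" and k: "odd k"
    and id: "\<And>p. p \<in> carrier C9C3 \<Longrightarrow> (\<alpha> ^^ k) p = p"
  obtains a b c where "a \<in> {1, 4, 7}" "b \<in> {0, 1, 2}" "c \<in> {0, 1, 2}"
    "\<And>p. p \<in> carrier C9C3 \<Longrightarrow> \<alpha> p = c9c3_aut a b c p"
proof -
  obtain a b c d where abc: "a \<in> {0..<9}" "b \<in> {0, 1, 2}" "c \<in> {0, 1, 2}" "d \<in> {0, 1, 2}"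
    and \<alpha>_eq: "\<And>x y. (x, y) \<in> carrier C9C3 \<Longrightarrow>
        \<alpha> (x, y) = ((a * x + 3 * b * y) mod 9, (c * x + d * y) mod 3)"
    using hom_C9C3[OF \<alpha>] by metis
  have carr: "(x, y) \<in> carrier C9C3 \<longleftrightarrow> 0 \<le> x \<and> x < 9 \<and> 0 \<le> y \<and> y < 3" for x y
    by (auto simp: carrier_C9C3)
  have 1: "\<exists>x y. (\<alpha> ^^ n) (1, 0) = (x, y) \<and> (x, y) \<in> carrier C9C3 \<and> x mod 3 = a ^ n mod 3" for n
  proof (induction n)
    case 0
    show ?case by (simp add: carr)
  next
    case (Suc n)
    then obtain x y where xy: "(\<alpha> ^^ n) (1, 0) = (x, y)" "(x, y) \<in> carrier C9C3" "x mod 3 = a ^ n mod 3"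
      by blast
    have "(a * x + 3 * b * y) mod 9 mod 3 = a * x mod 3"
      by (simp add: mod_mod_cancel mult.assoc)
    also have "\<dots> = a ^ Suc n mod 3"
      using xy(3) by (metis mod_mult_right_eq power_Suc)
    finally show ?case
      using xy \<alpha>_eq by (simp add: carr)
  qed
  \<comment> \<open>The orbit of \<open>(0, 1)\<close> stays among the elements killed by 3, so
    \<open>c\<close> never contributes to the second coordinate.\<close>
  have 2: "\<exists>x y. (\<alpha> ^^ n) (0, 1) = (3 * x, y) \<and> (3 * x, y) \<in> carrier C9C3 \<and> y mod 3 = d ^ n mod 3" for n
  proof (induction n)
    case 0
    show ?case by (rule exI[of _ 0]) (simp add: carr)
  next
    case (Suc n)
    then obtain x y where xy: "(\<alpha> ^^ n) (0, 1) = (3 * x, y)" "(3 * x, y) \<in> carrier C9C3" "y mod 3 = d ^ n mod 3"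
      by blast
    have "(c * (3 * x) + d * y) mod 3 = d * y mod 3"
      by (simp add: mult.left_commute[of c 3])
    also have "\<dots> = d ^ Suc n mod 3"
      using xy(3) by (metis mod_mult_right_eq power_Suc)
    finally have *: "(c * (3 * x) + d * y) mod 3 = d ^ Suc n mod 3" .
    have "(a * (3 * x) + 3 * b * y) mod 9 = 3 * ((a * x + b * y) mod 3)"
      by (simp add: mult_mod_right algebra_simps)
    then show ?case
      using xy \<alpha>_eq *
      by (intro exI[of _ "(a * x + b * y) mod 3"] exI[of _ "d ^ Suc n mod 3"])
        (simp add: carr del: power_Suc)
  qed
  have "a mod 3 = 1"
    using 1[of k] id[of "(1, 0)"] odd_power_mod_3[OF k, of a] by (auto simp: carr)
  then have a: "a \<in> {1, 4, 7}"
    using abc(1) by simp presburger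
  have "d mod 3 = 1"
    using 2[of k] id[of "(0, 1)"] odd_power_mod_3[OF k, of d] by (auto simp: carr)
  then have "d = 1"
    using abc(4) by auto
  then have "\<alpha> p = c9c3_aut a b c p" if "p \<in> carrier C9C3" for p
    using that \<alpha>_eq by (cases p) (simp add: c9c3_aut_def)
  with a abc show thesis
    using that by blast
qed

section \<open>Conjugation on \<open>H\<close> read in \<open>C9C3\<close>, and the
  conclusion\<close>

theorem (in normal) colourable_C9C3_extension:
  assumes odd: "odd (order G)" and iso: "G\<lparr>carrier := H\<rparr> \<cong> C9C3"
    and Q: "colourable (G Mod H)"
  shows "colourable G"
proof -
  let ?H = "G\<lparr>carrier := H\<rparr>"
  obtain f where f: "f \<in> iso ?H C9C3"
    using iso by (auto simp: is_iso_def)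
  define g where "g = inv_into H f"
  have grpH: "group ?H"
    using subgroup_is_group is_group by blast
  have g: "g \<in> iso C9C3 ?H"
    using group.iso_set_sym[OF grpH f] by (simp add: g_def)
  have gH: "g p \<in> H" "f (g p) = p" if "p \<in> carrier C9C3" for p
    using that f unfolding g_def iso_def bij_betw_def
    by (auto simp: inv_into_into f_inv_into_f)
  have fC: "f h \<in> carrier C9C3" "g (f h) = h" if "h \<in> H" for h
    using that f unfolding g_def iso_def bij_betw_def by (auto)
  have "\<exists>\<phi>. twisted_colouring ?H (\<lambda>h. y \<otimes> h \<otimes> inv y) \<phi>" if y: "y \<in> carrier G" for y
  proof -
    define \<alpha> where "\<alpha> p = f (y \<otimes> g p \<otimes> inv y)" for p
    have yH: "y \<otimes> h \<otimes> inv y \<in> H" if "h \<in> H" for h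
      using inv_op_closed2[OF y that] .
    have "\<alpha> \<in> hom C9C3 C9C3"
    proof (rule homI)
      fix p q assume p: "p \<in> carrier C9C3" and q: "q \<in> carrier C9C3"
      show "\<alpha> p \<in> carrier C9C3"
        using fC yH gH p by (simp add: \<alpha>_def)
      have "g (p \<otimes>\<^bsub>C9C3\<^esub> q) = g p \<otimes> g q"
        using hom_mult[of g C9C3 ?H p q] g p q by (simp add: iso_def)
      then have "y \<otimes> g (p \<otimes>\<^bsub>C9C3\<^esub> q) \<otimes> inv y = (y \<otimes> g p \<otimes> inv y) \<otimes> (y \<otimes> g q \<otimes> inv y)"
        using gH(1)[OF p] gH(1)[OF q] y by (simp add: m_assoc inv_solve_left' flip: m_assoc[of "inv y" y])
      then show "\<alpha> (p \<otimes>\<^bsub>C9C3\<^esub> q) = \<alpha> p \<otimes>\<^bsub>C9C3\<^esub> \<alpha> q"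
        using hom_mult[of f ?H C9C3 "y \<otimes> g p \<otimes> inv y" "y \<otimes> g q \<otimes> inv y"] f yH gH p q
        by (simp add: \<alpha>_def iso_def)
    qed
    \<comment> \<open>The \<open>n\<close>-th iterate of \<open>\<alpha>\<close> is conjugation by
      \<open>y [^] n\<close>, and \<open>y [^] order G\<close> is the identity;
      \<open>order G\<close> is odd, so the classification applies. Membership in \<open>H\<close>
      is carried through the induction so that \<open>g\<close> undoes \<open>f\<close>.\<close>
    moreover have "(\<alpha> ^^ order G) p = p" if p: "p \<in> carrier C9C3" for p
    proof -
      have "(\<alpha> ^^ n) p = f (y [^] n \<otimes> g p \<otimes> inv (y [^] n)) \<and> y [^] n \<otimes> g p \<otimes> inv (y [^] n) \<in> H" for n :: nat
      proof (induction n)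
        case 0
        show ?case using gH p by simp
      next
        case (Suc n)
        have "y \<otimes> (y [^] n \<otimes> g p \<otimes> inv (y [^] n)) \<otimes> inv y = y [^] Suc n \<otimes> g p \<otimes> inv (y [^] Suc n)"
          using y gH(1)[OF p] nat_pow_Suc2[OF y, of n] by (simp add: m_assoc inv_mult_group del: nat_pow_Suc)
        then show ?case
          using Suc yH[of "y [^] n \<otimes> g p \<otimes> inv (y [^] n)"] fC by (simp add: \<alpha>_def del: nat_pow_Suc)
      qed
      from this[of "order G"] show ?thesis
        using y gH p by (simp add: pow_order_eq_1)
    qed
    ultimately obtain a b c where abc: "a \<in> {1, 4, 7}" "b \<in> {0, 1, 2}" "c \<in> {0, 1, 2}"
      and \<alpha>: "\<And>p. p \<in> carrier C9C3 \<Longrightarrow> \<alpha> p = c9c3_aut a b c p"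
      using odd_order_aut_C9C3[OF _ odd] by metis
    obtain \<phi> where "twisted_colouring C9C3 (c9c3_aut a b c) \<phi>"
      using twisted_colouring_C9C3[OF abc] by blast
    then show ?thesis
    proof (rule twisted_colouring_iso[OF grpH group_C9C3 f, rotated])
      fix h assume "h \<in> carrier ?H"
      then show "y \<otimes> h \<otimes> inv y \<in> carrier ?H \<and> f (y \<otimes> h \<otimes> inv y) = c9c3_aut a b c (f h)"
        using yH \<alpha>[of "f h"] fC by (simp add: \<alpha>_def)
    qed
  qed
  with Q show ?thesis
    by (rule colourable_extension)
qed

theorem theorem3p6:
  fixes G :: "('a, 'b) monoid_scheme" and H :: "'a set"
  assumes "finite_p_group 3 G"
    and "H \<lhd> G"
    and "G\<lparr>carrier := H\<rparr> \<cong> integer_mod_group 9 \<times>\<times> integer_mod_group 3"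
    and "colourable (G Mod H)"
  shows "colourable G"
proof -
  interpret normal H G by fact
  have "odd (order G)"
    using assms(1) by (auto simp: finite_p_group_def)
  then show ?thesis
    using assms(3,4) by (rule colourable_C9C3_extension[unfolded C9C3_def])
qed

end
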